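(* Let $1<\alpha<2$ and let $n\ge 2$ be an integer. Then the function $\lambda\mapsto \lambda E_{-\lambda,\alpha,\alpha-1}(n,0)+E_{-\lambda,\alpha,\alpha-2}(n,0)$ has no real zeros $\lambda$ with $$|\lambda|<\frac{\alpha-1}{(n-1)^{2}}.$$
   Context: The generalized rising function is $t^{\overline{r}}=\Gamma(t+r)/\Gamma(t)$ for $t,t+r\in\mathbb{R}\setminus\{0,-1,-2,\dots\}$, and $0^{\overline r}:=0$. For $|p|<1$, $\alpha>0$ and $\beta\in\mathbb{R}$, the nabla Mittag-Leffler function is $$E_{p,\alpha,\beta}(t,a)=\sum_{k=0}^{\infty}p^{k}\frac{(t-a)^{\overline{\alpha k+\beta}}}{\Gamma(\alpha k+\beta+1)},\qquad t\in\{a,a+1,a+2,\dots\}.$$ *)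

theory Defs
  imports "HOL-Analysis.Analysis"
begin

text \<open>
  The quotient of Gamma values is meant for \<open>t, t + r \<notin> {0, -1, -2, \<dots>}\<close>; together with the
  convention for \<open>t = 0\<close> this is the intended domain, and values elsewhere carry no meaning.
\<close>

definition rising :: "real \<Rightarrow> real \<Rightarrow> real" where
  "rising t r = (if t = 0 then 0 else Gamma (t + r) / Gamma t)"

text \<open>
  The nabla Mittag-Leffler function \<open>E\<^sub>p\<^sub>,\<^sub>\<alpha>\<^sub>,\<^sub>\<beta>(t, a)\<close>, intended for \<open>\<bar>p\<bar> < 1\<close>, \<open>\<alpha> > 0\<close> and
  \<open>t \<in> {a, a + 1, a + 2, \<dots>}\<close>.
\<close>

definition nabla_ML :: "real \<Rightarrow> real \<Rightarrow> real \<Rightarrow> real \<Rightarrow> real \<Rightarrow> real" where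
  "nabla_ML p \<alpha> \<beta> t a =
     (\<Sum>k. p ^ k * (rising (t - a) (\<alpha> * real k + \<beta>) / Gamma (\<alpha> * real k + \<beta> + 1)))"

end

theory Submission
  imports Defs
begin

text \<open>
  Put \<open>m = n - 1\<close>, \<open>s = \<alpha> - 1\<close>, \<open>p = -\<lambda>\<close>, and let \<open>G(x) = x (x + 1) \<dots> (x + m - 1)\<close>. The Gamma
  quotients are values of \<open>G\<close>, and \<open>G(0) = 0\<close>, so absorbing the factor \<open>\<lambda>\<close> by an index shift
  turns the function in question, up to the factor \<open>\<Gamma>(n)\<close>, into \<open>\<Sum>\<^sub>k p\<^sup>k c\<^sub>k\<close> with
  \<open>c\<^sub>k = G(\<alpha>k + s) - G(\<alpha>k) > 0\<close>. Induction on \<open>m\<close> gives \<open>c\<^sub>k\<^sub>+\<^sub>1 \<le> (m\<^sup>2/s) c\<^sub>k\<close>, hence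
  \<open>\<bar>p\<bar> c\<^sub>k\<^sub>+\<^sub>1 < c\<^sub>k\<close>, and the series is positive because each pair of
  consecutive terms starting at an even index has positive sum.
\<close>

section \<open>Growth of rising factorials and of their differences under a shift\<close>

lemma pochhammer_real_mono:
  fixes x y :: real
  assumes "0 \<le> x" "x \<le> y"
  shows "pochhammer x m \<le> pochhammer y m"
  unfolding pochhammer_prod using assms by (intro prod_mono) auto

lemma pochhammer_real_strict_mono:
  fixes x y :: real
  assumes "0 \<le> x" "x < y" "0 < m"
  shows "pochhammer x m < pochhammer y m"
proof -
  obtain k where k: "m = Suc k" using assms(3) gr0_implies_Suc by blast
  have "x * pochhammer (x + 1) k \<le> x * pochhammer (y + 1) k"
    using assms by (intro mult_left_mono pochhammer_real_mono) auto
  also have "\<dots> < y * pochhammer (y + 1) k"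
    using assms by (intro mult_strict_right_mono pochhammer_pos) auto
  finally show ?thesis by (simp add: k pochhammer_rec)
qed

text \<open>The worst case is \<open>x = 1\<close>, \<open>t = 2\<close>, where equality holds. The
  constant is the ratio of consecutive values of \<open>(m + 1) * (m + 2) / 2\<close>, so it drives
  the inductions below.\<close>

lemma linear_factor_shift_le:
  fixes x t :: real
  assumes "1 \<le> x" "t \<le> 2"
  shows "x + t + real m \<le> (real m + 3) / (real m + 1) * (x + real m)"
proof -
  have "(x + t + real m) * (real m + 1) \<le> (x + 2 + real m) * (real m + 1)"
    using assms by (intro mult_right_mono) auto
  also have "\<dots> \<le> (real m + 3) * (x + real m)"
    using assms by (simp add: algebra_simps)
  finally show ?thesis by (simp add: field_simps)
qed

text \<open>The constant is \<open>pochhammer 3 m / pochhammer 1 m\<close>, the extremal case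
  \<open>x = 1\<close>, \<open>t = 2\<close>.\<close>

lemma pochhammer_shift_le:
  fixes x t :: real
  assumes "1 \<le> x" "0 \<le> t" "t \<le> 2"
  shows "pochhammer (x + t) m \<le> (real m + 1) * (real m + 2) / 2 * pochhammer x m"
proof (induction m)
  case (Suc m)
  have "pochhammer (x + t) (Suc m) = pochhammer (x + t) m * (x + t + real m)"
    by (simp add: pochhammer_Suc)
  also have "\<dots> \<le> ((real m + 1) * (real m + 2) / 2 * pochhammer x m) *
                    ((real m + 3) / (real m + 1) * (x + real m))"
    using assms Suc.IH linear_factor_shift_le[OF assms(1,3)]
    by (intro mult_mono) (auto intro!: mult_nonneg_nonneg pochhammer_nonneg)
  also have "\<dots> = (real (Suc m) + 1) * (real (Suc m) + 2) / 2 * pochhammer x (Suc m)"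
    by (simp add: pochhammer_Suc field_simps)
  finally show ?case .
qed simp

text \<open>A discrete product rule that splits off the last linear factor.\<close>

lemma pochhammer_diff_Suc:
  fixes x s :: real
  shows "pochhammer (x + s) (Suc m) - pochhammer x (Suc m) =
    (pochhammer (x + s) m - pochhammer x m) * (x + s + real m) + s * pochhammer x m"
  by (simp add: pochhammer_Suc algebra_simps)

text \<open>Both summands of the product rule grow by at most the same constant. With
  \<open>t = \<alpha>\<close> this compares consecutive coefficients from index 1 on.\<close>

lemma pochhammer_diff_shift_le:
  fixes x s t :: real
  assumes "1 \<le> x" "0 \<le> t" "t \<le> 2" "0 \<le> s"
  shows "pochhammer (x + t + s) m - pochhammer (x + t) m
    \<le> real m * (real m + 1) / 2 * (pochhammer (x + s) m - pochhammer x m)"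
proof (induction m)
  case (Suc m)
  let ?d = "\<lambda>x. pochhammer (x + s) m - pochhammer x m"
  let ?K = "(real m + 1) * (real m + 2) / 2"
  have d: "0 \<le> ?d y" if "0 \<le> y" for y
    using pochhammer_real_mono[of y "y + s" m] that assms by simp
  have "x + t + s + real m \<le> (real m + 3) / (real m + 1) * (x + s + real m)"
    using linear_factor_shift_le[of "x + s" t m] assms by (simp add: algebra_simps)
  then have "?d (x + t) * (x + t + s + real m)
      \<le> (real m * (real m + 1) / 2 * ?d x) * ((real m + 3) / (real m + 1) * (x + s + real m))"
    using assms Suc.IH d[of x] d[of "x + t"] by (intro mult_mono) auto
  also have "\<dots> = (real m * (real m + 3) / 2) * (?d x * (x + s + real m))"
    by (simp add: field_simps)
  \<comment> \<open>Here \<open>m * (m + 3) \<le> (m + 1) * (m + 2)\<close>; the slack of 2 is given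
    up so that both summands carry \<open>?K\<close>.\<close>
  also have "\<dots> \<le> ?K * (?d x * (x + s + real m))"
    using assms d[of x] by (intro mult_right_mono mult_nonneg_nonneg) (simp_all add: field_simps)
  finally have 1: "?d (x + t) * (x + t + s + real m) \<le> ?K * (?d x * (x + s + real m))" .
  have 2: "s * pochhammer (x + t) m \<le> s * (?K * pochhammer x m)"
    using assms by (intro mult_left_mono pochhammer_shift_le) auto
  have "pochhammer (x + t + s) (Suc m) - pochhammer (x + t) (Suc m)
      \<le> ?K * (?d x * (x + s + real m)) + s * (?K * pochhammer x m)"
    unfolding pochhammer_diff_Suc using 1 2 by linarith
  also have "\<dots> = real (Suc m) * (real (Suc m) + 1) / 2 *
      (pochhammer (x + s) (Suc m) - pochhammer x (Suc m))"
    unfolding pochhammer_diff_Suc by (simp add: field_simps)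
  finally show ?case .
qed simp

text \<open>This compares the coefficients at indices 0 and 1, where the base point is 0 and the
  previous shift bound does not apply. The factor \<open>s\<close> on the left turns
  \<open>pochhammer (1 + s) m\<close> into a multiple of \<open>pochhammer s m\<close>.\<close>

lemma pochhammer_diff_initial_le:
  fixes s :: real
  assumes "0 < s" "s \<le> 1"
  shows "s * (pochhammer (1 + s + s) m - pochhammer (1 + s) m)
    \<le> real m * (real m + 1) / 2 * pochhammer s m"
proof (induction m)
  case (Suc m)
  let ?d = "pochhammer (1 + s + s) m - pochhammer (1 + s) m"
  have shift: "s * pochhammer (1 + s) m = pochhammer s m * (s + real m)"
    by (metis pochhammer_rec pochhammer_Suc add.commute)
  have "s * (pochhammer (1 + s + s) (Suc m) - pochhammer (1 + s) (Suc m))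
      = s * ?d * (1 + s + s + real m) + s * (s * pochhammer (1 + s) m)"
    unfolding pochhammer_diff_Suc by (simp add: algebra_simps)
  also have "\<dots> \<le> real m * (real m + 1) / 2 * pochhammer s m * (1 + s + s + real m)
      + s * (pochhammer s m * (s + real m))"
    unfolding shift using assms Suc.IH by (intro add_mono mult_right_mono order.refl) auto
  also have "\<dots> = pochhammer s m * (real m * (real m + 1) / 2 * (1 + s + s + real m)
      + s * (s + real m))"
    by (simp add: algebra_simps)
  also have "\<dots> \<le> pochhammer s m * ((real m + 1) * (real m + 2) / 2 * (s + real m))"
  proof (intro mult_left_mono)
    \<comment> \<open>The right side minus the left is
      \<open>m * (1 - s) * (m + 1) / 2 + (s - s * s)\<close>.\<close>
    have "s * s \<le> s" using assms by (simp add: mult_left_le)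
    moreover have "0 \<le> real m * (1 - s) * (real m + 1)" using assms by simp
    ultimately show "real m * (real m + 1) / 2 * (1 + s + s + real m) + s * (s + real m)
        \<le> (real m + 1) * (real m + 2) / 2 * (s + real m)"
      by (simp add: field_simps)
  qed (use assms in \<open>auto intro: pochhammer_nonneg\<close>)
  also have "\<dots> = real (Suc m) * (real (Suc m) + 1) / 2 * pochhammer s (Suc m)"
    by (simp add: pochhammer_Suc field_simps)
  finally show ?case .
qed simp

section \<open>Convergence, and the Mittag-Leffler function as a power series\<close>

lemma summable_power_pochhammer:
  fixes p a b :: real
  assumes "\<bar>p\<bar> < 1" "0 \<le> a" "0 \<le> b"
  shows "summable (\<lambda>k. p ^ k * pochhammer (a * real k + b) m)"
  using assms(1)
proof (induction m arbitrary: p)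
  case 0
  then show ?case by (simp add: summable_geometric)
next
  case (Suc m)
  let ?G = "\<lambda>k. pochhammer (a * real k + b) m"
  \<comment> \<open>A radius strictly between \<open>\<bar>p\<bar>\<close> and 1: the decay of
    \<open>(\<bar>p\<bar> / q) ^ k\<close> absorbs the extra linear factor, and the induction
    hypothesis applies at \<open>q\<close>.\<close>
  define q where "q = (\<bar>p\<bar> + 1) / 2"
  have q: "\<bar>p\<bar> < q" "0 < q" "q < 1" using Suc.prems by (auto simp: q_def)
  have "summable (\<lambda>k. q ^ k * ?G k)" using q by (intro Suc.IH) auto
  moreover have "\<forall>\<^sub>F k in sequentially.
      norm (p ^ k * pochhammer (a * real k + b) (Suc m)) \<le> q ^ k * ?G k"
  proof -
    have "(\<lambda>k. a * (real k * (\<bar>p\<bar> / q) ^ k) + (b + real m) * (\<bar>p\<bar> / q) ^ k)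
        \<longlonglongrightarrow> a * 0 + (b + real m) * 0"
      using q by (intro tendsto_intros powser_times_n_limit_0 LIMSEQ_power_zero) auto
    then have "(\<lambda>k. (\<bar>p\<bar> / q) ^ k * (a * real k + b + real m)) \<longlonglongrightarrow> 0"
      by (simp add: algebra_simps)
    then have "\<forall>\<^sub>F k in sequentially. (\<bar>p\<bar> / q) ^ k * (a * real k + b + real m) < 1"
      by (rule order_tendstoD) simp
    then show ?thesis
    proof eventually_elim
      case (elim k)
      then have le: "\<bar>p\<bar> ^ k * (a * real k + b + real m) \<le> q ^ k"
        using q by (simp add: power_divide field_simps)
      have G: "0 \<le> ?G k" unfolding pochhammer_prod using assms by (intro prod_nonneg) auto
      have lin: "0 \<le> a * real k + b + real m" using assms by simp
      have "norm (p ^ k * pochhammer (a * real k + b) (Suc m))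
          = \<bar>p\<bar> ^ k * (a * real k + b + real m) * ?G k"
        using G lin by (simp add: pochhammer_Suc abs_mult power_abs)
      also have "\<dots> \<le> q ^ k * ?G k"
        using le G by (rule mult_right_mono)
      finally show ?case .
    qed
  qed
  ultimately show ?case
    by (rule summable_comparison_test_ev[rotated])
qed

text \<open>The Gamma quotient telescopes into \<open>n - 1\<close> linear factors;
  \<open>-1 < \<beta>\<close> keeps \<open>?z\<close> positive, away from the poles, even at
  \<open>k = 0\<close>.\<close>

lemma nabla_ML_eq_pochhammer:
  assumes "0 < \<alpha>" "-1 < \<beta>" "1 \<le> n"
  shows "nabla_ML p \<alpha> \<beta> (real n) 0 =
    (\<Sum>k. p ^ k * pochhammer (\<alpha> * real k + (\<beta> + 1)) (n - 1) / Gamma (real n))"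
  unfolding nabla_ML_def
proof (rule suminf_cong)
  fix k
  let ?z = "\<alpha> * real k + (\<beta> + 1)"
  have "0 < ?z" using assms by (simp add: add_nonneg_pos)
  then have "pochhammer ?z (n - 1) = Gamma (?z + real (n - 1)) / Gamma ?z"
    by (intro pochhammer_Gamma) (auto elim!: nonpos_Ints_cases)
  moreover have "?z + real (n - 1) = real n + (\<alpha> * real k + \<beta>)"
    using assms by (simp add: of_nat_diff)
  ultimately show "p ^ k * (rising (real n - 0) (\<alpha> * real k + \<beta>) / Gamma (\<alpha> * real k + \<beta> + 1))
      = p ^ k * pochhammer ?z (n - 1) / Gamma (real n)"
    using assms by (simp add: rising_def ac_simps)
qed

section \<open>Positivity of the series and the conclusion\<close>

lemma suminf_power_mult_pos:
  fixes p :: real and c :: "nat \<Rightarrow> real"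
  assumes "summable (\<lambda>k. p ^ k * c k)" and "\<And>k. 0 \<le> c k" and "\<And>k. \<bar>p\<bar> * c (Suc k) < c k"
  shows "0 < (\<Sum>k. p ^ k * c k)"
proof -
  let ?f = "\<lambda>k. p ^ k * c k"
  let ?g = "\<lambda>k. (p ^ 2) ^ k * (c (2 * k) + p * c (Suc (2 * k)))"
  have pair: "0 < c k + p * c (Suc k)" for k
  proof -
    have "- p * c (Suc k) \<le> \<bar>p\<bar> * c (Suc k)" using assms(2) by (intro mult_right_mono) auto
    then show ?thesis using assms(3)[of k] by simp
  qed
  have "(\<lambda>k. sum ?f {k * 2..<k * 2 + 2}) sums suminf ?f"
    using assms(1) by (intro sums_group summable_sums) auto
  moreover have "sum ?f {k * 2..<k * 2 + 2} = ?g k" for k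
    by (simp add: eval_nat_numeral algebra_simps power_mult_distrib power_add)
  ultimately have g: "?g sums suminf ?f" by simp
  have "0 < suminf ?g"
  proof (rule suminf_pos2[where i = 0])
    show "summable ?g" using g by (rule sums_summable)
    show "0 \<le> ?g k" for k using pair[of "2 * k"] by (intro mult_nonneg_nonneg) auto
    \<comment> \<open>Strictness comes from the first pair, whose weight is 1 even when
      \<open>p = 0\<close>.\<close>
    show "0 < ?g 0" using pair[of 0] by simp
  qed
  then show ?thesis using g by (simp add: sums_iff)
qed

theorem theorem3p8:
  fixes \<alpha> :: real and n :: nat
  assumes "1 < \<alpha>" and "\<alpha> < 2" and "n \<ge> 2"
  shows "\<not> (\<exists>l::real. \<bar>l\<bar> < (\<alpha> - 1) / (real n - 1)\<^sup>2 \<and>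
           l * nabla_ML (- l) \<alpha> (\<alpha> - 1) (real n) 0 + nabla_ML (- l) \<alpha> (\<alpha> - 2) (real n) 0 = 0)"
proof (intro notI, elim exE conjE)
  fix l :: real
  assume l: "\<bar>l\<bar> < (\<alpha> - 1) / (real n - 1)\<^sup>2"
    and zero: "l * nabla_ML (- l) \<alpha> (\<alpha> - 1) (real n) 0 + nabla_ML (- l) \<alpha> (\<alpha> - 2) (real n) 0 = 0"
  define m where "m = n - 1"
  define s where "s = \<alpha> - 1"
  define p where "p = - l"
  define A where "A = (\<lambda>k. p ^ k * pochhammer (\<alpha> * real k) m)"
  define B where "B = (\<lambda>k. p ^ k * pochhammer (\<alpha> * real k + s) m)"
  define c where "c = (\<lambda>k. pochhammer (\<alpha> * real k + s) m - pochhammer (\<alpha> * real k) m)"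
  have m: "0 < m" "real n = real m + 1" using assms by (auto simp: m_def of_nat_diff)
  have s: "0 < s" "s < 1" "\<alpha> = 1 + s" using assms by (auto simp: s_def)
  have Gam: "0 < Gamma (real n)" using assms by (intro Gamma_real_pos) auto
  have p: "\<bar>p\<bar> * (real m)\<^sup>2 < s" using l m by (simp add: p_def s_def field_simps)
  have "s / (real m)\<^sup>2 \<le> s / 1" using m s by (intro divide_left_mono) auto
  then have "\<bar>p\<bar> < 1" using l m s by (simp add: p_def)
  then have A: "summable A" and B: "summable B"
    using summable_power_pochhammer[of p \<alpha> 0 m] summable_power_pochhammer[of p \<alpha> s m] s
    by (simp_all add: A_def B_def)
  have "A 0 = 0" using m by (simp add: A_def pochhammer_0_left)
  \<comment> \<open>Since \<open>\<alpha> * k + \<alpha> = \<alpha> * (k + 1)\<close>, multiplying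
    by \<open>p\<close> gives the series of \<open>A\<close> without its vanishing head; the minus
    sign is \<open>l = - p\<close>.\<close>
  have "l * nabla_ML (- l) \<alpha> (\<alpha> - 1) (real n) 0 = - suminf A / Gamma (real n)"
  proof -
    have "summable (\<lambda>k. A (Suc k))" using A by (simp add: summable_Suc_iff)
    moreover have A_Suc: "A (Suc k) = p * (p ^ k * pochhammer (\<alpha> * real k + \<alpha>) m)" for k
      by (simp add: A_def algebra_simps)
    moreover have "summable (\<lambda>k. p ^ k * pochhammer (\<alpha> * real k + \<alpha>) m)"
      using s \<open>\<bar>p\<bar> < 1\<close> by (intro summable_power_pochhammer) auto
    ultimately have "p * (\<Sum>k. p ^ k * pochhammer (\<alpha> * real k + \<alpha>) m) = suminf A"
      using suminf_split_head[OF A] \<open>A 0 = 0\<close> by (simp add: suminf_mult)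
    moreover have "nabla_ML (- l) \<alpha> (\<alpha> - 1) (real n) 0
        = (\<Sum>k. p ^ k * pochhammer (\<alpha> * real k + \<alpha>) m) / Gamma (real n)"
      using assms \<open>summable (\<lambda>k. p ^ k * pochhammer (\<alpha> * real k + \<alpha>) m)\<close>
      by (subst nabla_ML_eq_pochhammer) (auto simp: p_def m_def suminf_divide)
    ultimately show ?thesis by (simp add: p_def minus_equation_iff eq_commute)
  qed
  moreover have "nabla_ML (- l) \<alpha> (\<alpha> - 2) (real n) 0 = suminf B / Gamma (real n)"
    using assms B
    by (subst nabla_ML_eq_pochhammer)
      (auto simp: p_def m_def s_def B_def suminf_divide)
  ultimately have "(suminf B - suminf A) / Gamma (real n) = 0"
    using zero by (simp add: diff_divide_distrib)
  then have "suminf B - suminf A = 0"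
    using Gam by simp
  moreover have "suminf B - suminf A = (\<Sum>k. p ^ k * c k)"
    using suminf_diff[OF B A] by (simp add: A_def B_def c_def algebra_simps)
  moreover have "0 < (\<Sum>k. p ^ k * c k)"
  proof (rule suminf_power_mult_pos)
    show "summable (\<lambda>k. p ^ k * c k)"
      using summable_diff[OF B A] by (simp add: A_def B_def c_def algebra_simps)
    have pos: "0 < c k" for k
      using pochhammer_real_strict_mono[of "\<alpha> * real k" "\<alpha> * real k + s" m] s m
      by (simp add: c_def)
    then show "0 \<le> c k" for k by (simp add: less_imp_le)
    \<comment> \<open>This needs \<open>m \<ge> 1\<close>, with equality at
      \<open>m = 1\<close>.\<close>
    have bound: "real m * (real m + 1) / 2 \<le> (real m)\<^sup>2"
      using m by (simp add: power2_eq_square field_simps)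
    show "\<bar>p\<bar> * c (Suc k) < c k" for k
    proof -
      have "s * c (Suc k) \<le> real m * (real m + 1) / 2 * c k"
      proof (cases k)
        case 0
        then show ?thesis
          using pochhammer_diff_initial_le[of s m] s m
          by (simp add: c_def pochhammer_0_left)
      next
        case (Suc j)
        have "1 * 1 \<le> \<alpha> * real k" using Suc s by (intro mult_mono) auto
        then have "c (Suc k) \<le> real m * (real m + 1) / 2 * c k"
          using pochhammer_diff_shift_le[of "\<alpha> * real k" \<alpha> s m] s
          by (simp add: c_def algebra_simps)
        \<comment> \<open>For \<open>k \<ge> 1\<close> the bound holds without \<open>s\<close>;
          inserting \<open>s < 1\<close> gives the form shared with \<open>k = 0\<close>.\<close>
        moreover have "s * c (Suc k) \<le> c (Suc k)" using s pos[of "Suc k"] by simp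
        ultimately show ?thesis by linarith
      qed
      also have "\<dots> \<le> (real m)\<^sup>2 * c k"
        using bound less_imp_le[OF pos] by (rule mult_right_mono)
      finally have "\<bar>p\<bar> * (s * c (Suc k)) \<le> \<bar>p\<bar> * ((real m)\<^sup>2 * c k)"
        by (rule mult_left_mono) simp
      also have "\<dots> = \<bar>p\<bar> * (real m)\<^sup>2 * c k" by simp
      also have "\<dots> < s * c k"
        using p pos by (rule mult_strict_right_mono)
      finally show ?thesis using s by (simp add: mult.left_commute)
    qed
  qed
  ultimately show False by simp
qed

end
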